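(* Let $k$ be a finite field and $l\ge2$. There exists no nontrivial joint determinant $D_l$ from the set of $l$-tuples of commuting invertible matrices over $k$ into $k^\times$.
   Context: For a field $k$, a joint determinant into an abelian group $G$ (here $G=k^\times$, written multiplicatively) is a map $D$ from the set of $l$-tuples of (pairwise) commuting matrices in $GL_n(k)$, for all $n\ge1$, into $G$ such that: (i) (Multilinearity) for commuting $A_1,\dots,A_l,B\in GL_n(k)$ and each $i$, $D(A_1,\dots,A_iB,\dots,A_l)=D(A_1,\dots,A_i,\dots,A_l)\cdot D(A_1,\dots,B,\dots,A_l)$ (with $B$ in the $i$-th position); (ii) (Block diagonal matrices) for commuting $A_1,\dots,A_l\in GL_m(k)$ and commuting $B_1,\dots,B_l\in GL_n(k)$, $D(A_1\oplus B_1,\dots,A_l\oplus B_l)=D(A_1,\dots,A_l)\cdot D(B_1,\dots,B_l)$, where $A\oplus B$ is the block diagonal matrix with blocks $A,B$; (iii) (Similar matrices) $D(SA_1S^{-1},\dots,SA_lS^{-1})=D(A_1,\dots,A_l)$ for commuting $A_1,\dots,A_l\in GL_n(k)$ and any $S\in GL_n(k)$; (iv) (Polynomial homotopy) $D(A_1(0),\dots,A_l(0))=D(A_1(1),\dots,A_l(1))$ for commuting $A_1(t),\dots,A_l(t)\in GL_n(k[t])$. It is nontrivial if it is not identically equal to the identity element of $G$. *)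

theory Defs
  imports "Jordan_Normal_Form.Matrix" "HOL-Computational_Algebra.Polynomial"
begin

text \<open>Jordan_Normal_Form matrices carry their dimensions as data, so one type holds the matrices
  of all sizes; an \<open>l\<close>-tuple of matrices is a list of length \<open>l\<close>. The ring is kept general because
  both \<open>k\<close> and \<open>k[t]\<close> are needed.\<close>

definition GL :: "nat \<Rightarrow> 'a::comm_ring_1 mat set" where
  "GL n = {A \<in> carrier_mat n n. invertible_mat A}"

definition commuting_GL :: "nat \<Rightarrow> nat \<Rightarrow> 'a::comm_ring_1 mat list set" where
  "commuting_GL l n =
     {As. length As = l \<and> set As \<subseteq> GL n \<and> (\<forall>A\<in>set As. \<forall>B\<in>set As. A * B = B * A)}"

definition commuting_tuples :: "nat \<Rightarrow> 'a::comm_ring_1 mat list set" where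
  "commuting_tuples l = (\<Union>n\<in>{1..}. commuting_GL l n)"

definition mat_direct_sum :: "'a::zero mat \<Rightarrow> 'a mat \<Rightarrow> 'a mat" where
  "mat_direct_sum A B = diag_block_mat [A, B]"

definition mat_eval :: "'a::comm_ring_1 poly mat \<Rightarrow> 'a \<Rightarrow> 'a mat" where
  "mat_eval A x = map_mat (\<lambda>p. poly p x) A"

text \<open>The value of \<open>D\<close> outside \<open>commuting_tuples l\<close> is irrelevant. In the first condition
  \<open>B # As\<close> being commuting says that \<open>B\<close> commutes with every entry of \<open>As\<close> as well, so that
  all three tuples to which \<open>D\<close> is applied are commuting. In the third condition \<open>T\<close> is the
  inverse of \<open>S\<close>.\<close>

definition joint_determinant ::
    "('g, 'b) monoid_scheme \<Rightarrow> nat \<Rightarrow> ('a::field mat list \<Rightarrow> 'g) \<Rightarrow> bool" where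
  "joint_determinant G l D \<longleftrightarrow>
     D \<in> commuting_tuples l \<rightarrow> carrier G \<and>
     (\<forall>n\<ge>1. \<forall>As B. B # As \<in> commuting_GL (Suc l) n \<longrightarrow>
        (\<forall>i<l. D (As[i := As ! i * B]) = D As \<otimes>\<^bsub>G\<^esub> D (As[i := B]))) \<and>
     (\<forall>m\<ge>1. \<forall>n\<ge>1. \<forall>As \<in> commuting_GL l m. \<forall>Bs \<in> commuting_GL l n.
        D (map2 mat_direct_sum As Bs) = D As \<otimes>\<^bsub>G\<^esub> D Bs) \<and>
     (\<forall>n\<ge>1. \<forall>As \<in> commuting_GL l n. \<forall>S \<in> GL n. \<forall>T \<in> carrier_mat n n.
        inverts_mat S T \<and> inverts_mat T S \<longrightarrow> D (map (\<lambda>A. S * A * T) As) = D As) \<and>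
     (\<forall>n\<ge>1. \<forall>As \<in> commuting_GL l n.
        D (map (\<lambda>A. mat_eval A 0) As) = D (map (\<lambda>A. mat_eval A 1) As))"

definition nontrivial_joint_determinant ::
    "('g, 'b) monoid_scheme \<Rightarrow> nat \<Rightarrow> ('a::field mat list \<Rightarrow> 'g) \<Rightarrow> bool" where
  "nontrivial_joint_determinant G l D \<longleftrightarrow>
     joint_determinant G l D \<and> (\<exists>As \<in> commuting_tuples l. D As \<noteq> \<one>\<^bsub>G\<^esub>)"

definition mult_group :: "'a::field monoid" where
  "mult_group = \<lparr>carrier = {x. x \<noteq> 0}, mult = (*), one = 1\<rparr>"

lemma comm_group_mult_group: "comm_group (mult_group :: 'a::field monoid)"
proof (rule comm_groupI)
  fix x :: 'a assume "x \<in> carrier mult_group"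
  then show "\<exists>y\<in>carrier mult_group. y \<otimes>\<^bsub>mult_group\<^esub> x = \<one>\<^bsub>mult_group\<^esub>"
    by (intro bexI[of _ "inverse x"]) (auto simp: mult_group_def)
qed (auto simp: mult_group_def)

end

theory Submission
  imports Defs "Jordan_Normal_Form.Determinant" "HOL-Algebra.Multiplicative_Group" "HOL-Algebra.Subrings"
begin

text \<open>Two kinds of polynomial homotopy determine a joint determinant \<open>D\<close> over a finite field \<open>k\<close>. Scaling the upper
right blocks by \<open>t\<close> shows that \<open>D\<close> of a simultaneously block triangular tuple is the product of its values on
the diagonal blocks (lemma \<open>D_block_triangular\<close>). The path \<open>(1 + t N) A\<close> with \<open>N\<^sup>2 = 0\<close> shows that \<open>D\<close> does not
change when \<open>A\<close> is replaced by \<open>(1 + N) A\<close> in a tuple whose entries are all either \<open>A\<close> or a scalar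
(lemma \<open>D_transvection\<close>).

By the first homotopy and induction on the size it suffices to treat commuting tuples
without a common invariant subspace. Such a tuple lies in a finite field of matrices, so its entries are powers of one
matrix \<open>g\<close> (lemma \<open>commuting_cyclic_or_triangular\<close>), and multilinearity expresses its value through
\<open>D (g, \<dots>, g)\<close>. By the second homotopy, Gaussian elimination applies to \<open>g\<close>, and \<open>D (g, \<dots>, g)\<close> becomes a product
of values at \<open>1 \<times> 1\<close> matrices. These are powers of \<open>\<epsilon> = D (h, \<dots>, h)\<close> for a generator \<open>h\<close> of the multiplicative
group of \<open>k\<close>. Everything is thus reduced to \<open>\<epsilon> = 1\<close>.

For this, choose an irreducible polynomial \<open>X\<^sup>2 - s X + h\<close> with companion matrix \<open>C\<close>. Elimination computes
both \<open>D (C, C, \<dots>, C)\<close> and \<open>D (h, C, \<dots>, C)\<close> as \<open>\<epsilon>\<close> (lemma \<open>D_companion2\<close>); the second value requires two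
slots. On the other hand \<open>C\<close> and \<open>h\<close> are powers of a generator of the multiplicative group of the field \<open>k[C]\<close>, and
comparing determinants shows that replacing \<open>C\<close> by \<open>h\<close> in one slot squares the value. Hence \<open>\<epsilon> = \<epsilon>\<^sup>2\<close>
(lemma \<open>D_replicate_primitive\<close>).\<close>

section \<open>Invertible matrices and commuting tuples\<close>

lemma GL_iff:
  "A \<in> GL n \<longleftrightarrow> A \<in> carrier_mat n n \<and> (\<exists>B\<in>carrier_mat n n. A * B = 1\<^sub>m n \<and> B * A = 1\<^sub>m n)"
proof
  assume "A \<in> GL n"
  then obtain B where A: "A \<in> carrier_mat n n" and AB: "A * B = 1\<^sub>m n" and BA: "B * A = 1\<^sub>m (dim_row B)"
    by (auto simp: GL_def invertible_mat_def inverts_mat_def)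
  have "dim_col B = n" using arg_cong[OF AB, of dim_col] by simp
  moreover have "dim_row B = n" using arg_cong[OF BA, of dim_col] A by simp
  ultimately have "B \<in> carrier_mat n n" by auto
  with A AB BA show "A \<in> carrier_mat n n \<and> (\<exists>B\<in>carrier_mat n n. A * B = 1\<^sub>m n \<and> B * A = 1\<^sub>m n)"
    by auto
qed (auto simp: GL_def invertible_mat_def inverts_mat_def)

lemma GL_I:
  "A \<in> carrier_mat n n \<Longrightarrow> B \<in> carrier_mat n n \<Longrightarrow> A * B = 1\<^sub>m n \<Longrightarrow> B * A = 1\<^sub>m n \<Longrightarrow> A \<in> GL n"
  by (auto simp: GL_iff)

lemma GL_carrier: "A \<in> GL n \<Longrightarrow> A \<in> carrier_mat n n"
  by (simp add: GL_def)

lemma GL_iff_det: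
  fixes A :: "'a::field mat"
  shows "A \<in> GL n \<longleftrightarrow> A \<in> carrier_mat n n \<and> det A \<noteq> 0"
proof
  assume "A \<in> GL n"
  then obtain B where "A \<in> carrier_mat n n" "B \<in> carrier_mat n n" "A * B = 1\<^sub>m n"
    by (auto simp: GL_iff)
  with det_mult[of A n B] show "A \<in> carrier_mat n n \<and> det A \<noteq> 0" by auto
next
  assume "A \<in> carrier_mat n n \<and> det A \<noteq> 0"
  with det_non_zero_imp_unit[of A n undefined] show "A \<in> GL n"
    by (auto simp: GL_iff Units_def ring_mat_simps)
qed

lemma one_GL: "1\<^sub>m n \<in> GL n"
  by (rule GL_I[of _ _ "1\<^sub>m n"]) auto

lemma mult_GL:
  assumes "A \<in> GL n" "B \<in> GL n"
  shows "A * B \<in> GL n"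
proof -
  obtain A' where A: "A \<in> carrier_mat n n" "A' \<in> carrier_mat n n" "A * A' = 1\<^sub>m n" "A' * A = 1\<^sub>m n"
    using assms(1) by (auto simp: GL_iff)
  obtain B' where B: "B \<in> carrier_mat n n" "B' \<in> carrier_mat n n" "B * B' = 1\<^sub>m n" "B' * B = 1\<^sub>m n"
    using assms(2) by (auto simp: GL_iff)
  have "A * B * (B' * A') = A * (B * B') * A'" using A(1,2) B(1,2) by (simp add: assoc_mult_mat[of _ n n _ n _ n])
  moreover have "B' * A' * (A * B) = B' * (A' * A) * B" using A(1,2) B(1,2) by (simp add: assoc_mult_mat[of _ n n _ n _ n])
  ultimately show ?thesis
    using A B by (intro GL_I[of _ _ "B' * A'"]) auto
qed

lemma pow_GL: "A \<in> GL n \<Longrightarrow> A ^\<^sub>m e \<in> GL n"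
  by (induction e) (auto simp: one_GL mult_GL dest: GL_carrier)

lemma smult_one_commute:
  fixes A :: "'a::comm_ring_1 mat"
  assumes "A \<in> carrier_mat n n"
  shows "(c \<cdot>\<^sub>m 1\<^sub>m n) * A = A * (c \<cdot>\<^sub>m 1\<^sub>m n)"
  using assms mult_smult_assoc_mat[of "1\<^sub>m n" n n A n c] mult_smult_distrib[of A n n "1\<^sub>m n" n c]
  by simp

lemma smult_one_GL:
  fixes c d :: "'a::comm_ring_1"
  assumes "c * d = 1"
  shows "c \<cdot>\<^sub>m 1\<^sub>m n \<in> GL n"
proof (rule GL_I)
  show "(c \<cdot>\<^sub>m 1\<^sub>m n) * (d \<cdot>\<^sub>m 1\<^sub>m n) = 1\<^sub>m n" "(d \<cdot>\<^sub>m 1\<^sub>m n) * (c \<cdot>\<^sub>m 1\<^sub>m n) = 1\<^sub>m n"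
    using assms by (auto simp: mult_smult_assoc_mat[of _ n n _ n] mult.commute intro!: eq_matI)
qed auto

lemma transvection_GL:
  fixes N :: "'a::comm_ring_1 mat"
  assumes N: "N \<in> carrier_mat n n" and "N * N = 0\<^sub>m n n"
  shows "1\<^sub>m n + N \<in> GL n"
proof (rule GL_I)
  have 1: "(1\<^sub>m n + N) * (1\<^sub>m n - N) = 1\<^sub>m n + N - (N + N * N)"
    using N by (simp add: add_mult_distrib_mat[of _ n n _ _ n] mult_minus_distrib_mat[of _ n n _ n])
  show "(1\<^sub>m n + N) * (1\<^sub>m n - N) = 1\<^sub>m n"
    unfolding 1 using assms by (intro eq_matI) auto
  have 2: "(1\<^sub>m n - N) * (1\<^sub>m n + N) = 1\<^sub>m n + N - (N + N * N)"
    using N by (simp add: minus_mult_distrib_mat[of _ n n _ _ n] mult_add_distrib_mat[of _ n n _ n])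
  show "(1\<^sub>m n - N) * (1\<^sub>m n + N) = 1\<^sub>m n"
    unfolding 2 using assms by (intro eq_matI) auto
qed (use N in auto)

lemma pow_mat_add:
  "A \<in> carrier_mat n n \<Longrightarrow> (A :: 'a::comm_ring_1 mat) ^\<^sub>m (d + e) = A ^\<^sub>m d * A ^\<^sub>m e"
  by (induction e) (auto simp: assoc_mult_mat[of _ n n _ n _ n])

lemma pow_mat_commute:
  "A \<in> carrier_mat n n \<Longrightarrow> (A :: 'a::comm_ring_1 mat) ^\<^sub>m d * A ^\<^sub>m e = A ^\<^sub>m e * A ^\<^sub>m d"
  by (metis add.commute pow_mat_add)

lemma commuting_GL_I:
  assumes "length As = l" "\<And>A. A \<in> set As \<Longrightarrow> A \<in> GL n"
    "\<And>A B. A \<in> set As \<Longrightarrow> B \<in> set As \<Longrightarrow> A * B = B * A"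
  shows "As \<in> commuting_GL l n"
  using assms by (auto simp: commuting_GL_def)

lemma commuting_GL_pair:
  assumes "A \<in> GL n" "C \<in> GL n" "C * A = A * C" "length bs = l"
  shows "map (\<lambda>b. if b then A else C) bs \<in> commuting_GL l n"
  using assms by (intro commuting_GL_I) (auto split: if_splits)

lemma commuting_GL_replicate: "A \<in> GL n \<Longrightarrow> replicate m A \<in> commuting_GL m n"
  by (auto simp: commuting_GL_def)

lemma commuting_GL_powers:
  assumes "g \<in> GL n" "length es = m"
  shows "map (\<lambda>e. g ^\<^sub>m e) es \<in> commuting_GL m n"
  using assms by (intro commuting_GL_I) (auto simp: pow_GL pow_mat_commute[OF GL_carrier])

section \<open>Commuting matrices over a finite field\<close>

lemma mult_mat_entry:
  assumes "A \<in> carrier_mat m n" "B \<in> carrier_mat n r" "i < m" "j < r"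
  shows "(A * B) $$ (i, j) = (\<Sum>k<n. A $$ (i, k) * B $$ (k, j))"
  using assms by (simp add: scalar_prod_def atLeast0LessThan)

definition block_triangular :: "nat \<Rightarrow> 'a::zero mat \<Rightarrow> bool" where
  "block_triangular r A \<longleftrightarrow> (\<forall>i j. r \<le> i \<longrightarrow> i < dim_row A \<longrightarrow> j < r \<longrightarrow> A $$ (i, j) = 0)"

text \<open>The kernel of a matrix is invariant under everything that commutes with it; here the kernel of row
vectors is used. If \<open>P B\<close> is the row echelon form of \<open>B\<close>, its last \<open>n - r\<close> rows are zero and its first \<open>r\<close>
rows are independent, so in the coordinates given by \<open>P\<close> the left kernel of \<open>B\<close> is spanned by the last
\<open>n - r\<close> basis vectors. Invariance of this span is the vanishing of the lower left block.\<close>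

lemma singular_commutant_triangular:
  fixes B :: "'a::field mat"
  assumes B: "B \<in> carrier_mat n n" and "B \<noteq> 0\<^sub>m n n" and "B \<notin> GL n"
  obtains P T r where
    "P \<in> carrier_mat n n" "T \<in> carrier_mat n n" "P * T = 1\<^sub>m n" "T * P = 1\<^sub>m n" "0 < r" "r < n"
    "\<And>A. A \<in> carrier_mat n n \<Longrightarrow> A * B = B * A \<Longrightarrow> block_triangular r (P * A * T)"
proof -
  obtain P T where C: "gauss_jordan_single B = P * B" and PT: "P \<in> carrier_mat n n" "T \<in> carrier_mat n n"
      "P * T = 1\<^sub>m n" "T * P = 1\<^sub>m n"
    using gauss_jordan_single(4)[OF B refl] by blast
  have ref: "row_echelon_form (P * B)" using gauss_jordan_single(3)[OF B refl] C by simp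
  have PBc: "P * B \<in> carrier_mat n n" using PT B by auto
  obtain f where f: "pivot_fun (P * B) f n"
    using ref PBc by (auto simp: row_echelon_form_def)
  have dim: "dim_row (P * B) = n" using PT by auto
  note pf = pivot_funD[OF dim f]
  have ne1: "P * B \<noteq> 1\<^sub>m n"
  proof
    assume PB: "P * B = 1\<^sub>m n"
    then have "B * P = 1\<^sub>m n" using mat_mult_left_right_inverse[OF PT(1) B] by simp
    then have "B \<in> GL n" using B PT(1) PB by (intro GL_I)
    with assms show False by simp
  qed
  then have n: "n > 0" and row: "row (P * B) (n - 1) = 0\<^sub>v n"
    using row_echelon_form_imp_1_or_0_row[OF PBc ref] by auto
  then have last: "f (n - 1) = n"
    using pivot_fun_zero_row_iff[OF f PBc, of "n - 1"] by simp
  \<comment> \<open>A pivot position \<open>n\<close> marks a zero row, so \<open>r\<close> is the rank of \<open>B\<close>.\<close>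
  define r where "r = (LEAST i. f i = n)"
  have fr: "f r = n" and rn: "r < n"
    using LeastI[of "\<lambda>i. f i = n", OF last] Least_le[of "\<lambda>i. f i = n", OF last] n
    by (auto simp: r_def)
  have below: "f j < n" if "j < r" for j
    using not_less_Least[of j "\<lambda>i. f i = n"] pf(1)[of j] that rn by (auto simp: r_def)
  have above: "f i = n" if "r \<le> i" "i < n" for i
    using pivot_bound[OF dim f, of r "i - r"] that fr pf(1)[of i] by auto
  have zero_row: "(P * B) $$ (i, j) = 0" if "r \<le> i" "i < n" "j < n" for i j
    using pf(2)[of i j] above that by auto
  have "r > 0"
  proof (rule ccontr)
    assume "\<not> r > 0"
    then have "P * B = 0\<^sub>m n n" using zero_row PT B by (intro eq_matI) auto
    then have "T * (P * B) = 0\<^sub>m n n" using PT by simp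
    moreover have "T * (P * B) = T * P * B" using PT(1,2) B by (simp add: assoc_mult_mat[of _ n n _ n _ n])
    ultimately show False using PT B assms(2) by simp
  qed
  moreover have "block_triangular r (P * A * T)"
    if A: "A \<in> carrier_mat n n" "A * B = B * A" for A
    unfolding block_triangular_def
  proof (intro allI impI)
    fix i j assume "r \<le> i" "i < dim_row (P * A * T)" "j < r"
    then have ij: "r \<le> i" "i < n" "j < r" using PT(1) by simp_all
    \<comment> \<open>Row \<open>i\<close> of \<open>(P A T) (P B) = P A B = P B A\<close> vanishes because row \<open>i\<close> of \<open>P B\<close> does, and
      the pivot column \<open>f j\<close> of \<open>P B\<close>, a unit vector, reads off the entry \<open>(i, j)\<close> of \<open>P A T\<close>.\<close>
    have "(P * A * T) * (P * B) = P * A * (T * P) * B"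
      using A(1) PT(1,2) B by (simp add: assoc_mult_mat[of _ n n _ n _ n])
    also have "\<dots> = P * (A * B)" using A(1) PT B by (simp add: assoc_mult_mat[of _ n n _ n _ n])
    also have "\<dots> = P * B * A"
      unfolding A(2) using A(1) PT(1) B by (simp add: assoc_mult_mat[of _ n n _ n _ n])
    finally have eq: "(P * A * T) * (P * B) = P * B * A" .
    have fj: "f j < n" using below ij by simp
    have "((P * A * T) * (P * B)) $$ (i, f j) = (\<Sum>k<n. (P * A * T) $$ (i, k) * (P * B) $$ (k, f j))"
      using ij fj A PT B by (intro mult_mat_entry[of _ n n _ n]) auto
    also have "\<dots> = (\<Sum>k<n. if k = j then (P * A * T) $$ (i, j) else 0)"
      using pf(4)[of j] pf(5)[of j] fj ij rn by (intro sum.cong) auto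
    also have "\<dots> = (P * A * T) $$ (i, j)" using ij rn by simp
    also have "((P * A * T) * (P * B)) $$ (i, f j) = (\<Sum>k<n. (P * B) $$ (i, k) * A $$ (k, f j))"
      unfolding eq using ij fj A PBc by (intro mult_mat_entry[of _ n n _ n]) auto
    also have "\<dots> = 0" using zero_row ij by (intro sum.neutral) auto
    finally show "(P * A * T) $$ (i, j) = 0" by simp
  qed
  ultimately show thesis using PT rn by (intro that[of P T r])
qed

lemma finite_carrier_mat: "finite (carrier_mat m n :: 'a::finite mat set)"
proof -
  have "carrier_mat m n \<subseteq> (\<lambda>f. mat m n f) ` (({..<m} \<times> {..<n}) \<rightarrow>\<^sub>E (UNIV :: 'a set))"
  proof
    fix A :: "'a mat" assume "A \<in> carrier_mat m n"
    then have "A = mat m n (restrict (\<lambda>ij. A $$ ij) ({..<m} \<times> {..<n}))"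
      by (intro eq_matI) auto
    then show "A \<in> (\<lambda>f. mat m n f) ` (({..<m} \<times> {..<n}) \<rightarrow>\<^sub>E (UNIV :: 'a set))"
      by (rule image_eqI[where f = "mat m n"]) auto
  qed
  then show ?thesis by (rule finite_subset) (intro finite_imageI finite_PiE; auto)
qed

lemma zero_not_GL:
  assumes "n \<ge> 1"
  shows "0\<^sub>m n n \<notin> GL n"
proof
  assume "0\<^sub>m n n \<in> (GL n :: 'a mat set)"
  then obtain B :: "'a mat" where "B \<in> carrier_mat n n" "0\<^sub>m n n * B = 1\<^sub>m n"
    by (auto simp: GL_iff)
  then have "(0\<^sub>m n n :: 'a mat) = 1\<^sub>m n" by simp
  from arg_cong[OF this, of "\<lambda>M. M $$ (0, 0)"] assms show False by simp
qed

definition centralizer_mat :: "nat \<Rightarrow> 'a::comm_ring_1 mat set \<Rightarrow> 'a mat set" where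
  "centralizer_mat n X = {B \<in> carrier_mat n n. \<forall>A\<in>X. A * B = B * A}"

lemma subring_centralizer_mat:
  assumes "X \<subseteq> carrier_mat n n"
  shows "subring (centralizer_mat n X) (ring_mat TYPE('a::comm_ring_1) n ())"
proof -
  interpret ring "ring_mat TYPE('a) n ()" by (rule ring_mat)
  have neg: "\<ominus>\<^bsub>ring_mat TYPE('a) n ()\<^esub> B = - B" if "B \<in> carrier_mat n n" for B
    using that by (intro minus_equality) (auto simp: ring_mat_simps)
  have X: "A \<in> carrier_mat n n" if "A \<in> X" for A using assms that by auto
  show ?thesis
  proof (rule subringI)
    fix B C assume BC: "B \<in> centralizer_mat n X" "C \<in> centralizer_mat n X"
    then have Bc: "B \<in> carrier_mat n n" and Cc: "C \<in> carrier_mat n n"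
      by (auto simp: centralizer_mat_def)
    have "A * (B * C) = B * C * A" if A: "A \<in> X" for A
    proof -
      have AB: "A * B = B * A" and AC: "A * C = C * A" using BC A by (auto simp: centralizer_mat_def)
      have "A * (B * C) = A * B * C" using Bc Cc X[OF A] by simp
      also have "\<dots> = B * (A * C)" unfolding AB using Bc Cc X[OF A] by simp
      also have "\<dots> = B * C * A" unfolding AC using Bc Cc X[OF A] by simp
      finally show ?thesis .
    qed
    with BC show "B \<otimes>\<^bsub>ring_mat TYPE('a) n ()\<^esub> C \<in> centralizer_mat n X"
      by (auto simp: centralizer_mat_def ring_mat_simps)
    show "B \<oplus>\<^bsub>ring_mat TYPE('a) n ()\<^esub> C \<in> centralizer_mat n X"
      using BC X by (auto simp: centralizer_mat_def ring_mat_simps mult_add_distrib_mat[of _ n n _ n] add_mult_distrib_mat[of _ n n _ _ n])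
  next
    fix B assume B: "B \<in> centralizer_mat n X"
    then show "\<ominus>\<^bsub>ring_mat TYPE('a) n ()\<^esub> B \<in> centralizer_mat n X"
      using X[THEN carrier_matD(1)] X[THEN carrier_matD(2)] by (auto simp: centralizer_mat_def neg)
  qed (use X[THEN carrier_matD(1)] X[THEN carrier_matD(2)] X in
      \<open>auto simp: centralizer_mat_def ring_mat_simps\<close>)
qed

text \<open>The double centralizer of a commuting set is a commutative ring of matrices which contains the set,
and it contains the inverse of each of its invertible elements. If all its nonzero elements
are invertible, it is therefore a finite field, whose multiplicative group is cyclic.\<close>

lemma bicommutant_cyclic:
  fixes X :: "'a::{field,finite} mat set"
  assumes X: "X \<subseteq> carrier_mat n n" and n: "n \<ge> 1"
    and comm: "\<And>A B. A \<in> X \<Longrightarrow> B \<in> X \<Longrightarrow> A * B = B * A"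
    and inv: "\<And>B. B \<in> centralizer_mat n (centralizer_mat n X) \<Longrightarrow> B \<noteq> 0\<^sub>m n n \<Longrightarrow> B \<in> GL n"
  obtains g where "g \<in> GL n" "\<And>A. A \<in> X \<Longrightarrow> A \<noteq> 0\<^sub>m n n \<Longrightarrow> \<exists>e. A = g ^\<^sub>m e"
proof -
  define Z where "Z = centralizer_mat n X"
  define L where "L = centralizer_mat n Z"
  define R where "R = ring_mat TYPE('a) n ()"
  interpret ring R unfolding R_def by (rule ring_mat)
  have Rs: "mult R = (*)" "one R = 1\<^sub>m n" "zero R = 0\<^sub>m n n" "carrier R = carrier_mat n n"
    by (simp_all add: R_def ring_mat_simps)
  have Z: "Z \<subseteq> carrier_mat n n" by (auto simp: Z_def centralizer_mat_def)
  have XZ: "X \<subseteq> Z" using X comm by (auto simp: Z_def centralizer_mat_def)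
  have XL: "X \<subseteq> L" using X by (auto simp: L_def Z_def centralizer_mat_def)
  have Lc: "L \<subseteq> carrier_mat n n" by (auto simp: L_def centralizer_mat_def)
  have LZ: "L \<subseteq> Z" using XZ by (force simp: L_def Z_def centralizer_mat_def)
  have sub: "subring L R"
    unfolding L_def R_def by (rule subring_centralizer_mat[OF Z])
  have scr: "subcring L R"
    using sub LZ by (intro subcringI) (auto simp: L_def centralizer_mat_def Rs)
  have "Units (R\<lparr>carrier := L\<rparr>) = L - {\<zero>\<^bsub>R\<^esub>}"
  proof (intro equalityI subsetI)
    fix B assume "B \<in> Units (R\<lparr>carrier := L\<rparr>)"
    then obtain C where B: "B \<in> L" "C \<in> L" "C * B = 1\<^sub>m n" by (auto simp: Units_def Rs)
    have "B \<noteq> 0\<^sub>m n n"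
    proof
      assume "B = 0\<^sub>m n n"
      with B Lc have "(0\<^sub>m n n :: 'a mat) = 1\<^sub>m n" by auto
      from arg_cong[OF this, of "\<lambda>M. M $$ (0, 0)"] n show False by simp
    qed
    with B show "B \<in> L - {\<zero>\<^bsub>R\<^esub>}" by (simp add: Rs)
  next
    fix B assume "B \<in> L - {\<zero>\<^bsub>R\<^esub>}"
    then have B: "B \<in> L" "B \<in> GL n" using inv by (auto simp: Rs L_def Z_def)
    then obtain C where C: "C \<in> carrier_mat n n" "B * C = 1\<^sub>m n" "C * B = 1\<^sub>m n" by (auto simp: GL_iff)
    have Bc: "B \<in> carrier_mat n n" using B Lc by auto
    have "A * C = C * A" if "A \<in> Z" for A
    proof -
      have A: "A \<in> carrier_mat n n" "A * B = B * A" using that Z B by (auto simp: L_def centralizer_mat_def)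
      have "A * C = C * B * A * C" using A C by simp
      also have "\<dots> = C * (B * A) * C" using A(1) Bc C(1) by (simp add: assoc_mult_mat[of _ n n _ n _ n])
      also have "\<dots> = C * A * (B * C)" unfolding A(2)[symmetric] using A(1) Bc C(1) by (simp add: assoc_mult_mat[of _ n n _ n _ n])
      finally show ?thesis using A C by simp
    qed
    then have "C \<in> L" using C by (auto simp: L_def centralizer_mat_def)
    with B C show "B \<in> Units (R\<lparr>carrier := L\<rparr>)" by (auto simp: Units_def Rs)
  qed
  then have "field (R\<lparr>carrier := L\<rparr>)"
    using subfield_iff(2)[OF subfieldI[OF scr]] Lc by (simp add: Rs)
  then interpret F: field "R\<lparr>carrier := L\<rparr>" .
  have "finite L" using Lc finite_carrier_mat finite_subset by blast
  then obtain g where g: "g \<in> L" "g \<noteq> 0\<^sub>m n n"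
      and gen: "L - {0\<^sub>m n n} = {g [^]\<^bsub>R\<lparr>carrier := L\<rparr>\<^esub> i | i::nat. True}"
    using F.finite_field_mult_group_has_gen by (auto simp: Rs mult_of_def nat_pow_def)
  have pow: "g [^]\<^bsub>R\<lparr>carrier := L\<rparr>\<^esub> i = g ^\<^sub>m i" for i :: nat
    using g Lc by (induction i) (auto simp: Rs)
  show thesis
  proof (rule that)
    show "g \<in> GL n" using g inv by (auto simp: L_def Z_def)
    show "\<exists>e. A = g ^\<^sub>m e" if "A \<in> X" "A \<noteq> 0\<^sub>m n n" for A
    proof -
      have "A \<in> L - {0\<^sub>m n n}" using that XL by auto
      then show ?thesis unfolding gen pow by auto
    qed
  qed
qed

text \<open>This dichotomy is what a composition series provides in module theory: commuting matrices
without a common invariant subspace lie in a field by Schur's lemma. The double centralizer either is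
a field or contains a nonzero singular matrix, whose kernel is a common invariant subspace.\<close>

lemma commuting_cyclic_or_triangular:
  fixes X :: "'a::{field,finite} mat set"
  assumes X: "X \<subseteq> GL n" and n: "n \<ge> 1"
    and comm: "\<forall>A\<in>X. \<forall>B\<in>X. A * B = B * A"
  obtains (cyclic) g where "g \<in> GL n" "\<And>A. A \<in> X \<Longrightarrow> \<exists>e. A = g ^\<^sub>m e"
  | (triangular) P T r where
    "P \<in> carrier_mat n n" "T \<in> carrier_mat n n" "P * T = 1\<^sub>m n" "T * P = 1\<^sub>m n" "0 < r" "r < n"
    "\<And>A. A \<in> X \<Longrightarrow> block_triangular r (P * A * T)"
proof (cases "\<exists>B\<in>centralizer_mat n (centralizer_mat n X). B \<noteq> 0\<^sub>m n n \<and> B \<notin> GL n")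
  case True
  have Xc: "X \<subseteq> carrier_mat n n" using X GL_carrier by auto
  from True obtain B where B: "B \<in> centralizer_mat n (centralizer_mat n X)" "B \<noteq> 0\<^sub>m n n" "B \<notin> GL n"
    by auto
  have "A * B = B * A" if "A \<in> X" for A
    using that B(1) Xc comm by (auto simp: centralizer_mat_def)
  then have comm: "A \<in> carrier_mat n n" "A * B = B * A" if "A \<in> X" for A
    using that Xc by auto
  have "B \<in> carrier_mat n n" using B(1) by (simp add: centralizer_mat_def)
  from this B(2,3) show thesis
  proof (rule singular_commutant_triangular)
    fix P T r assume "P \<in> carrier_mat n n" "T \<in> carrier_mat n n" "P * T = 1\<^sub>m n" "T * P = 1\<^sub>m n" "0 < r" "r < n"
      "\<And>A. A \<in> carrier_mat n n \<Longrightarrow> A * B = B * A \<Longrightarrow> block_triangular r (P * A * T)"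
    then show thesis
      using comm by (intro triangular[of P T r]) blast+
  qed
next
  case False
  have Xc: "X \<subseteq> carrier_mat n n" using X GL_carrier by auto
  have nz: "A \<noteq> 0\<^sub>m n n" if "A \<in> X" for A
    using that X zero_not_GL[OF n] by auto
  show thesis
  proof (rule bicommutant_cyclic[OF Xc n])
    show "A * B = B * A" if "A \<in> X" "B \<in> X" for A B
      using comm that by blast
    show "B \<in> GL n" if "B \<in> centralizer_mat n (centralizer_mat n X)" "B \<noteq> 0\<^sub>m n n" for B
      using False that by blast
    fix g assume "g \<in> GL n" "\<And>A. A \<in> X \<Longrightarrow> A \<noteq> 0\<^sub>m n n \<Longrightarrow> \<exists>e. A = g ^\<^sub>m e"
    with nz show thesis by (intro cyclic[of g]) blast+
  qed
qed

section \<open>Polynomial paths of matrices\<close>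

text \<open>Both homotopies that occur below are built from matrices whose entry at \<open>(i, j)\<close> is
\<open>a\<^sub>i\<^sub>j t\<^sup>e\<close> with an exponent that depends on the position only.\<close>

definition monom_mat :: "(nat \<Rightarrow> nat \<Rightarrow> nat) \<Rightarrow> 'a::comm_ring_1 mat \<Rightarrow> 'a poly mat" where
  "monom_mat e A = mat (dim_row A) (dim_col A) (\<lambda>(i, j). Polynomial.monom (A $$ (i, j)) (e i j))"

lemma monom_mat_carrier [simp]: "A \<in> carrier_mat m n \<Longrightarrow> monom_mat e A \<in> carrier_mat m n"
  by (simp add: monom_mat_def)

text \<open>If the exponents are additive along all pairs of nonzero entries, every summand of a product entry
carries the same power of \<open>t\<close>. The weights \<open>e i j = w j - w i\<close> satisfy this for matrices that are triangular
with respect to \<open>w\<close>: they describe conjugation by a diagonal matrix of powers of \<open>t\<close>.\<close>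

lemma monom_mat_mult:
  assumes A: "A \<in> carrier_mat m n" and B: "B \<in> carrier_mat n r"
    and e: "\<And>i k j. i < m \<Longrightarrow> k < n \<Longrightarrow> j < r \<Longrightarrow> A $$ (i, k) \<noteq> 0 \<Longrightarrow> B $$ (k, j) \<noteq> 0
      \<Longrightarrow> e1 i k + e2 k j = e i j"
  shows "monom_mat e1 A * monom_mat e2 B = monom_mat e (A * B)"
proof (rule eq_matI)
  fix i j assume "i < dim_row (monom_mat e (A * B))" "j < dim_col (monom_mat e (A * B))"
  with A B have ij: "i < m" "j < r" by (simp_all add: monom_mat_def)
  have "(monom_mat e1 A * monom_mat e2 B) $$ (i, j)
      = (\<Sum>k<n. monom_mat e1 A $$ (i, k) * monom_mat e2 B $$ (k, j))"
    using A B ij by (intro mult_mat_entry[of _ m n _ r]) auto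
  also have "\<dots> = (\<Sum>k<n. Polynomial.monom (A $$ (i, k) * B $$ (k, j)) (e i j))"
  proof (intro sum.cong refl)
    fix k assume "k \<in> {..<n}"
    then show "monom_mat e1 A $$ (i, k) * monom_mat e2 B $$ (k, j)
        = Polynomial.monom (A $$ (i, k) * B $$ (k, j)) (e i j)"
      using A B ij e[of i k j]
      by (cases "A $$ (i, k) = 0 \<or> B $$ (k, j) = 0") (auto simp: monom_mat_def mult_monom)
  qed
  also have "\<dots> = Polynomial.monom (\<Sum>k<n. A $$ (i, k) * B $$ (k, j)) (e i j)"
    by (simp add: monom_sum)
  also have "\<dots> = monom_mat e (A * B) $$ (i, j)"
    using A B ij by (simp add: monom_mat_def mult_mat_entry[of A m n B r] del: index_mult_mat(1))
  finally show "(monom_mat e1 A * monom_mat e2 B) $$ (i, j) = monom_mat e (A * B) $$ (i, j)" .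
qed (use A B in \<open>auto simp: monom_mat_def\<close>)

lemma monom_mat_one: "(\<And>i. i < n \<Longrightarrow> e i i = 0) \<Longrightarrow> monom_mat e (1\<^sub>m n) = 1\<^sub>m n"
  by (rule eq_matI) (auto simp: monom_mat_def)

lemma monom_mat_zero: "monom_mat e (0\<^sub>m m n) = 0\<^sub>m m n"
  by (rule eq_matI) (auto simp: monom_mat_def)

lemma mat_eval_monom_mat:
  "mat_eval (monom_mat e A) x = mat (dim_row A) (dim_col A) (\<lambda>(i, j). A $$ (i, j) * x ^ e i j)"
  by (rule eq_matI) (auto simp: mat_eval_def monom_mat_def poly_monom)

lemma mat_eval_carrier [simp]: "A \<in> carrier_mat m n \<Longrightarrow> mat_eval A x \<in> carrier_mat m n"
  by (simp add: mat_eval_def)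

lemma mat_eval_mult:
  assumes "A \<in> carrier_mat m n" "B \<in> carrier_mat n r"
  shows "mat_eval (A * B) x = mat_eval A x * mat_eval B x"
  using assms by (intro eq_matI) (auto simp: mat_eval_def scalar_prod_def poly_sum)

lemma mat_eval_add:
  assumes "A \<in> carrier_mat m n" "B \<in> carrier_mat m n"
  shows "mat_eval (A + B) x = mat_eval A x + mat_eval B x"
  using assms by (intro eq_matI) (auto simp: mat_eval_def)

lemma mat_eval_one: "mat_eval (1\<^sub>m n) x = 1\<^sub>m n"
  by (rule eq_matI) (auto simp: mat_eval_def)

lemma mat_eval_smult_one: "mat_eval ([:c:] \<cdot>\<^sub>m 1\<^sub>m n) x = c \<cdot>\<^sub>m 1\<^sub>m n"
  by (rule eq_matI) (auto simp: mat_eval_def)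

section \<open>Diagonal blocks of triangular matrices\<close>

definition upper_left :: "nat \<Rightarrow> 'a mat \<Rightarrow> 'a mat" where
  "upper_left r A = mat r r (\<lambda>(i, j). A $$ (i, j))"

definition lower_right :: "nat \<Rightarrow> 'a mat \<Rightarrow> 'a mat" where
  "lower_right r A = mat (dim_row A - r) (dim_col A - r) (\<lambda>(i, j). A $$ (i + r, j + r))"

lemma sum_lessThan_skip:
  fixes f :: "nat \<Rightarrow> 'a::comm_monoid_add"
  assumes "r \<le> n" "\<And>k. k < r \<Longrightarrow> f k = 0"
  shows "sum f {..<n} = (\<Sum>k<n - r. f (k + r))"
proof -
  have "sum f {..<r + m} = (\<Sum>k<m. f (k + r))" for m
    using assms(2) by (induction m) (auto simp: add.commute)
  from this[of "n - r"] assms(1) show ?thesis by simp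
qed

lemma sum_lessThan_cut:
  fixes f :: "nat \<Rightarrow> 'a::comm_monoid_add"
  assumes "r \<le> n" "\<And>k. r \<le> k \<Longrightarrow> k < n \<Longrightarrow> f k = 0"
  shows "sum f {..<n} = sum f {..<r}"
  using assms by (intro sum.mono_neutral_right) auto

lemma upper_left_mult:
  fixes A B :: "'a::comm_ring_1 mat"
  assumes "A \<in> carrier_mat n n" "B \<in> carrier_mat n n" "r \<le> n" "block_triangular r B"
  shows "upper_left r (A * B) = upper_left r A * upper_left r B"
proof (rule eq_matI)
  fix i j assume "i < dim_row (upper_left r A * upper_left r B)" "j < dim_col (upper_left r A * upper_left r B)"
  then have ij: "i < r" "j < r" by (auto simp: upper_left_def)
  have "upper_left r (A * B) $$ (i, j) = (\<Sum>k<n. A $$ (i, k) * B $$ (k, j))"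
    using assms ij mult_mat_entry[of A n n B n i j] by (simp add: upper_left_def del: index_mult_mat(1))
  also have "\<dots> = (\<Sum>k<r. A $$ (i, k) * B $$ (k, j))"
    using assms ij by (intro sum_lessThan_cut) (auto simp: block_triangular_def)
  also have "\<dots> = (\<Sum>k<r. upper_left r A $$ (i, k) * upper_left r B $$ (k, j))"
    using ij by (simp add: upper_left_def)
  also have "\<dots> = (upper_left r A * upper_left r B) $$ (i, j)"
    using ij by (intro mult_mat_entry[symmetric, of _ r r _ r]) (auto simp: upper_left_def)
  finally show "upper_left r (A * B) $$ (i, j) = (upper_left r A * upper_left r B) $$ (i, j)" .
qed (auto simp: upper_left_def)

lemma lower_right_carrier: "A \<in> carrier_mat n n \<Longrightarrow> lower_right r A \<in> carrier_mat (n - r) (n - r)"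
  by (simp add: lower_right_def)

lemma upper_left_carrier: "upper_left r A \<in> carrier_mat r r"
  by (simp add: upper_left_def)

lemma lower_rows_mult:
  fixes A B :: "'a::comm_ring_1 mat"
  assumes "A \<in> carrier_mat n n" "B \<in> carrier_mat n n" "r \<le> n" "block_triangular r A" "i < n - r" "j < n"
  shows "(A * B) $$ (i + r, j) = (\<Sum>k<n - r. lower_right r A $$ (i, k) * B $$ (k + r, j))"
proof -
  have "(A * B) $$ (i + r, j) = (\<Sum>k<n. A $$ (i + r, k) * B $$ (k, j))"
    using assms by (intro mult_mat_entry) auto
  also have "\<dots> = (\<Sum>k<n - r. A $$ (i + r, k + r) * B $$ (k + r, j))"
    using assms by (intro sum_lessThan_skip) (auto simp: block_triangular_def)
  also have "\<dots> = (\<Sum>k<n - r. lower_right r A $$ (i, k) * B $$ (k + r, j))"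
    using assms by (intro sum.cong) (auto simp: lower_right_def)
  finally show ?thesis .
qed

lemma lower_right_mult:
  fixes A B :: "'a::comm_ring_1 mat"
  assumes "A \<in> carrier_mat n n" "B \<in> carrier_mat n n" "r \<le> n" "block_triangular r A"
  shows "lower_right r (A * B) = lower_right r A * lower_right r B"
proof (rule eq_matI)
  fix i j assume "i < dim_row (lower_right r A * lower_right r B)" "j < dim_col (lower_right r A * lower_right r B)"
  then have ij: "i < n - r" "j < n - r" using assms by (auto simp: lower_right_def)
  have "lower_right r (A * B) $$ (i, j) = (A * B) $$ (i + r, j + r)"
    using assms ij by (simp add: lower_right_def del: index_mult_mat(1))
  also have "\<dots> = (\<Sum>k<n - r. lower_right r A $$ (i, k) * B $$ (k + r, j + r))"
    using assms ij by (intro lower_rows_mult) auto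
  also have "\<dots> = (\<Sum>k<n - r. lower_right r A $$ (i, k) * lower_right r B $$ (k, j))"
    using assms ij by (intro sum.cong) (auto simp: lower_right_def)
  also have "\<dots> = (lower_right r A * lower_right r B) $$ (i, j)"
    using ij assms lower_right_carrier[of _ n r]
    by (intro mult_mat_entry[symmetric, of _ "n - r" "n - r" _ "n - r"]) auto
  finally show "lower_right r (A * B) $$ (i, j) = (lower_right r A * lower_right r B) $$ (i, j)" .
qed (use assms in \<open>auto simp: lower_right_def\<close>)

lemma upper_left_one: "r \<le> n \<Longrightarrow> upper_left r (1\<^sub>m n) = 1\<^sub>m r"
  by (rule eq_matI) (auto simp: upper_left_def)

lemma lower_right_one: "lower_right r (1\<^sub>m n) = 1\<^sub>m (n - r)"
  by (rule eq_matI) (auto simp: lower_right_def)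

text \<open>If \<open>Z\<close> and \<open>W\<close> are the lower right blocks of \<open>A\<close> and \<open>B\<close>, and \<open>R\<close> is the lower left block of \<open>B\<close>, then
\<open>A B = 1\<close> says \<open>Z W = 1\<close> and \<open>Z R = 0\<close>; hence \<open>R = W Z R = 0\<close>.\<close>

lemma block_triangular_inverse:
  fixes A B :: "'a::field mat"
  assumes A: "A \<in> carrier_mat n n" and B: "B \<in> carrier_mat n n" and AB: "A * B = 1\<^sub>m n"
    and r: "r \<le> n" and tri: "block_triangular r A"
  shows "block_triangular r B"
proof -
  let ?Z = "lower_right r A" and ?W = "lower_right r B"
  define R where "R = mat (n - r) r (\<lambda>(i, j). B $$ (i + r, j))"
  have R: "R \<in> carrier_mat (n - r) r" by (simp add: R_def)
  have Z: "?Z \<in> carrier_mat (n - r) (n - r)" and W: "?W \<in> carrier_mat (n - r) (n - r)"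
    using lower_right_carrier A B by auto
  have "?Z * ?W = 1\<^sub>m (n - r)"
    using lower_right_mult[OF A B r tri] by (simp add: AB lower_right_one)
  then have WZ: "?W * ?Z = 1\<^sub>m (n - r)" by (rule mat_mult_left_right_inverse[OF Z W])
  have "?Z * R = 0\<^sub>m (n - r) r"
  proof (rule eq_matI)
    fix i j assume "i < dim_row (0\<^sub>m (n - r) r :: 'a mat)" "j < dim_col (0\<^sub>m (n - r) r :: 'a mat)"
    then have ij: "i < n - r" "j < r" by auto
    have "(?Z * R) $$ (i, j) = (\<Sum>k<n - r. ?Z $$ (i, k) * R $$ (k, j))"
      using Z R ij by (intro mult_mat_entry) auto
    also have "\<dots> = (\<Sum>k<n - r. ?Z $$ (i, k) * B $$ (k + r, j))"
      using ij by (intro sum.cong) (auto simp: R_def)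
    also have "\<dots> = (A * B) $$ (i + r, j)"
      using lower_rows_mult[OF A B r tri, of i j] ij r by simp
    also have "\<dots> = 0" unfolding AB using ij r by auto
    finally show "(?Z * R) $$ (i, j) = 0\<^sub>m (n - r) r $$ (i, j)" using ij by simp
  qed (use Z R in auto)
  then have "?W * (?Z * R) = 0\<^sub>m (n - r) r" using W by simp
  then have R0: "R = 0\<^sub>m (n - r) r"
    using WZ R assoc_mult_mat[OF W Z R] by simp
  show ?thesis
    unfolding block_triangular_def
  proof (intro allI impI)
    fix i j assume "r \<le> i" "i < dim_row B" "j < r"
    with arg_cong[OF R0, of "\<lambda>M. M $$ (i - r, j)"] B show "B $$ (i, j) = 0"
      by (simp add: R_def)
  qed
qed

lemma mat_direct_sum_four_block:
  "mat_direct_sum A B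
   = four_block_mat A (0\<^sub>m (dim_row A) (dim_col B)) (0\<^sub>m (dim_row B) (dim_col A)) B"
  unfolding mat_direct_sum_def diag_block_mat.simps(2)[of A] diag_block_mat_singleton Let_def ..

section \<open>Homotopies and multilinearity for joint determinants\<close>

locale joint_det =
  fixes l :: nat and D :: "'k::field mat list \<Rightarrow> 'k"
  assumes jd: "joint_determinant mult_group l D"
begin

lemma D_nonzero: "As \<in> commuting_GL l n \<Longrightarrow> n \<ge> 1 \<Longrightarrow> D As \<noteq> 0"
  using jd by (auto simp: joint_determinant_def mult_group_def commuting_tuples_def Pi_iff)

lemma D_mult_slot:
  assumes "As \<in> commuting_GL l n" "B \<in> GL n" "n \<ge> 1" "i < l" "\<And>A. A \<in> set As \<Longrightarrow> A * B = B * A"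
  shows "D (As[i := As ! i * B]) = D As * D (As[i := B])"
proof -
  have "B # As \<in> commuting_GL (Suc l) n"
    using assms(1,2,5) by (auto simp: commuting_GL_def)
  then show ?thesis
    using jd assms(3,4) by (auto simp: joint_determinant_def mult_group_def)
qed

lemma D_direct_sum:
  assumes "As \<in> commuting_GL l m" "Bs \<in> commuting_GL l n" "m \<ge> 1" "n \<ge> 1"
  shows "D (map2 mat_direct_sum As Bs) = D As * D Bs"
  using jd assms by (simp add: joint_determinant_def mult_group_def)

lemma D_similar:
  assumes "As \<in> commuting_GL l n" "n \<ge> 1" "S \<in> carrier_mat n n" "T \<in> carrier_mat n n"
    "S * T = 1\<^sub>m n" "T * S = 1\<^sub>m n"
  shows "D (map (\<lambda>A. S * A * T) As) = D As"
proof -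
  have "S \<in> GL n" using assms by (intro GL_I)
  with assms jd show ?thesis by (auto simp: joint_determinant_def inverts_mat_def)
qed

lemma D_homotopy:
  assumes "As \<in> commuting_GL l n" "n \<ge> 1"
  shows "D (map (\<lambda>A. mat_eval A 0) As) = D (map (\<lambda>A. mat_eval A 1) As)"
  using jd assms by (auto simp: joint_determinant_def)

text \<open>The path \<open>(1 + t N) A\<close> is invertible with inverse \<open>A\<inverse> (1 - t N)\<close>, and it commutes with itself and with
scalars. So in tuples made of one matrix \<open>A\<close> and one scalar, Gaussian elimination applies to \<open>A\<close>. The list \<open>bs\<close> marks
the slots that hold \<open>A\<close>.\<close>

lemma D_transvection:
  assumes A: "A \<in> GL n" and N: "N \<in> carrier_mat n n" "N * N = 0\<^sub>m n n"
    and n: "n \<ge> 1" and c: "c \<noteq> 0" and bs: "length bs = l"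
  shows "D (map (\<lambda>b. if b then (1\<^sub>m n + N) * A else c \<cdot>\<^sub>m 1\<^sub>m n) bs)
       = D (map (\<lambda>b. if b then A else c \<cdot>\<^sub>m 1\<^sub>m n) bs)"
proof -
  define M where "M = monom_mat (\<lambda>_ _. 1) N"
  define P where "P = monom_mat (\<lambda>_ _. 0) A"
  define H where "H = (1\<^sub>m n + M) * P"
  obtain B where Ac: "A \<in> carrier_mat n n" and B: "B \<in> carrier_mat n n" "A * B = 1\<^sub>m n" "B * A = 1\<^sub>m n"
    using A by (auto simp: GL_iff)
  have Mc: "M \<in> carrier_mat n n" and Pc: "P \<in> carrier_mat n n"
    using N Ac by (auto simp: M_def P_def)
  have "M * M = 0\<^sub>m n n"
    unfolding M_def using N monom_mat_mult[OF N(1) N(1), of "\<lambda>_ _. 1" "\<lambda>_ _. 1" "\<lambda>_ _. 2"]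
    by (simp add: monom_mat_zero)
  then have MG: "1\<^sub>m n + M \<in> GL n" using Mc by (intro transvection_GL)
  have PG: "P \<in> GL n"
  proof (rule GL_I)
    show "P * monom_mat (\<lambda>_ _. 0) B = 1\<^sub>m n" "monom_mat (\<lambda>_ _. 0) B * P = 1\<^sub>m n"
      using monom_mat_mult[OF Ac B(1), of "\<lambda>_ _. 0" "\<lambda>_ _. 0" "\<lambda>_ _. 0"]
        monom_mat_mult[OF B(1) Ac, of "\<lambda>_ _. 0" "\<lambda>_ _. 0" "\<lambda>_ _. 0"] B
      by (simp_all add: P_def monom_mat_one)
  qed (use Pc B in auto)
  have HG: "H \<in> GL n" unfolding H_def by (rule mult_GL[OF MG PG])
  have evM: "mat_eval M x = x \<cdot>\<^sub>m N" for x
    using N by (intro eq_matI) (auto simp: M_def mat_eval_monom_mat)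
  have evP: "mat_eval P x = A" for x
    using Ac by (intro eq_matI) (auto simp: P_def mat_eval_monom_mat)
  have ev: "mat_eval H x = (1\<^sub>m n + x \<cdot>\<^sub>m N) * A" for x
    using Mc Pc by (simp add: H_def mat_eval_mult[of _ n n _ n] mat_eval_add[of _ n n] mat_eval_one evM evP)
  have "0 \<cdot>\<^sub>m N = 0\<^sub>m n n" "1 \<cdot>\<^sub>m N = N" using N by (auto intro!: eq_matI)
  with ev Ac have ev0: "mat_eval H 0 = A" and ev1: "mat_eval H 1 = (1\<^sub>m n + N) * A"
    by simp_all
  have "map (\<lambda>b. if b then H else [:c:] \<cdot>\<^sub>m 1\<^sub>m n) bs \<in> commuting_GL l n"
    using HG c bs by (intro commuting_GL_pair smult_one_GL[of _ "[:1 / c:]"] smult_one_commute GL_carrier) (auto simp: one_pCons)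
  from D_homotopy[OF this n] show ?thesis
    by (simp add: o_def if_distrib[of "\<lambda>A. mat_eval A _"] mat_eval_smult_one ev0 ev1 cong: if_cong)
qed

text \<open>Multiplying the upper right blocks by \<open>t\<close> is conjugation by a diagonal matrix with entries \<open>1\<close> and \<open>1 / t\<close>,
hence compatible with products as long as the lower left blocks vanish. At \<open>t = 1\<close> the path gives the
triangular tuple and at \<open>t = 0\<close> its block diagonal part.\<close>

lemma D_block_triangular:
  assumes As: "As \<in> commuting_GL l n" and r: "0 < r" "r < n"
    and tri: "\<And>A. A \<in> set As \<Longrightarrow> block_triangular r A"
  shows "map (upper_left r) As \<in> commuting_GL l r"
    and "map (lower_right r) As \<in> commuting_GL l (n - r)"
    and "D As = D (map (upper_left r) As) * D (map (lower_right r) As)"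
proof -
  have G: "A \<in> GL n" and comm: "A * B = B * A"
    if "A \<in> set As" "B \<in> set As" for A B
    using As that by (auto simp: commuting_GL_def)
  have len: "length As = l" using As by (auto simp: commuting_GL_def)
  have carr: "A \<in> carrier_mat n n" if "A \<in> set As" for A
    using G GL_carrier that by auto
  have inv: "\<exists>B\<in>carrier_mat n n. A * B = 1\<^sub>m n \<and> B * A = 1\<^sub>m n \<and> block_triangular r B" if "A \<in> set As" for A
    using G[OF that that] block_triangular_inverse[of A n _ r] tri[OF that] r by (auto simp: GL_iff)
  show ul: "map (upper_left r) As \<in> commuting_GL l r"
  proof (rule commuting_GL_I)
    fix X assume "X \<in> set (map (upper_left r) As)"
    then obtain A where A: "A \<in> set As" "X = upper_left r A" by auto
    obtain B where B: "B \<in> carrier_mat n n" "A * B = 1\<^sub>m n" "B * A = 1\<^sub>m n" "block_triangular r B"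
      using inv[OF A(1)] by auto
    have "X * upper_left r B = 1\<^sub>m r" "upper_left r B * X = 1\<^sub>m r"
      using upper_left_mult[OF carr[OF A(1)] B(1), of r] upper_left_mult[OF B(1) carr[OF A(1)], of r]
        B r tri[OF A(1)] by (auto simp: upper_left_one A(2))
    then show "X \<in> GL r" using A(2) by (intro GL_I) (auto simp: upper_left_carrier)
  next
    fix X Y assume "X \<in> set (map (upper_left r) As)" "Y \<in> set (map (upper_left r) As)"
    then obtain A B where A: "A \<in> set As" "X = upper_left r A" and B: "B \<in> set As" "Y = upper_left r B" by auto
    then show "X * Y = Y * X"
      using upper_left_mult[OF carr carr, of A B r] upper_left_mult[OF carr carr, of B A r] comm[of A B] tri r
      by auto
  qed (simp add: len)
  show lr: "map (lower_right r) As \<in> commuting_GL l (n - r)"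
  proof (rule commuting_GL_I)
    fix X assume "X \<in> set (map (lower_right r) As)"
    then obtain A where A: "A \<in> set As" "X = lower_right r A" by auto
    obtain B where B: "B \<in> carrier_mat n n" "A * B = 1\<^sub>m n" "B * A = 1\<^sub>m n" "block_triangular r B"
      using inv[OF A(1)] by auto
    have "X * lower_right r B = 1\<^sub>m (n - r)" "lower_right r B * X = 1\<^sub>m (n - r)"
      using lower_right_mult[OF carr[OF A(1)] B(1), of r] lower_right_mult[OF B(1) carr[OF A(1)], of r]
        B r tri[OF A(1)] by (auto simp: lower_right_one A(2))
    then show "X \<in> GL (n - r)" using A B carr by (intro GL_I) (auto simp: lower_right_carrier)
  next
    fix X Y assume "X \<in> set (map (lower_right r) As)" "Y \<in> set (map (lower_right r) As)"
    then obtain A B where A: "A \<in> set As" "X = lower_right r A" and B: "B \<in> set As" "Y = lower_right r B" by auto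
    then show "X * Y = Y * X"
      using lower_right_mult[OF carr carr, of A B r] lower_right_mult[OF carr carr, of B A r] comm[of A B] tri r
      by auto
  qed (simp add: len)
  \<comment> \<open>For nonzero entries \<open>w i \<le> w j\<close>, so the truncated subtraction in the exponents is exact.\<close>
  define w where "w i = (if i < r then 0 else 1 :: nat)" for i
  define H :: "'k mat \<Rightarrow> 'k poly mat" where "H = monom_mat (\<lambda>i j. w j - w i)"
  have nz: "w i \<le> w j" if "block_triangular r A" "A \<in> carrier_mat n n" "i < n" "A $$ (i, j) \<noteq> 0"
    for A :: "'k mat" and i j
    using that by (auto simp: w_def block_triangular_def)
  have mult: "H A * H B = H (A * B)"
    if "A \<in> carrier_mat n n" "B \<in> carrier_mat n n" "block_triangular r A" "block_triangular r B" for A B :: "'k mat"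
    unfolding H_def using that(1,2)
  proof (rule monom_mat_mult)
    fix i k j assume ikj: "i < n" "k < n" "j < n" "A $$ (i, k) \<noteq> 0" "B $$ (k, j) \<noteq> 0"
    then have "w i \<le> w k" "w k \<le> w j"
      using nz[of A i k] nz[of B k j] that by auto
    then show "w k - w i + (w j - w k) = w j - w i" by simp
  qed
  have H1: "H (1\<^sub>m n) = 1\<^sub>m n" unfolding H_def by (rule monom_mat_one) simp
  have "map H As \<in> commuting_GL l n"
  proof (rule commuting_GL_I)
    fix X assume "X \<in> set (map H As)"
    then obtain A where A: "A \<in> set As" "X = H A" by auto
    obtain B where B: "B \<in> carrier_mat n n" "A * B = 1\<^sub>m n" "B * A = 1\<^sub>m n" "block_triangular r B"
      using inv[OF A(1)] by auto
    have "X * H B = 1\<^sub>m n" "H B * X = 1\<^sub>m n"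
      using mult[OF carr[OF A(1)] B(1)] mult[OF B(1) carr[OF A(1)]] B tri[OF A(1)] H1 by (auto simp: A(2))
    then show "X \<in> GL n" using A B carr by (intro GL_I) (auto simp: H_def)
  next
    fix X Y assume "X \<in> set (map H As)" "Y \<in> set (map H As)"
    then obtain A B where A: "A \<in> set As" "X = H A" and B: "B \<in> set As" "Y = H B" by auto
    then show "X * Y = Y * X"
      using mult[OF carr carr, of A B] mult[OF carr carr, of B A] comm[of A B] tri by auto
  qed (simp add: len)
  from D_homotopy[OF this] r
  have "D (map (\<lambda>A. mat_eval (H A) 0) As) = D (map (\<lambda>A. mat_eval (H A) 1) As)"
    by (simp add: o_def)
  moreover have "map (\<lambda>A. mat_eval (H A) 1) As = As"
    using carr by (intro map_idI eq_matI) (auto simp: H_def mat_eval_monom_mat)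
  moreover have "mat_eval (H A) 0 = mat_direct_sum (upper_left r A) (lower_right r A)" if "A \<in> set As" for A
  proof (rule eq_matI)
    have A: "A \<in> carrier_mat n n" using carr that by simp
    show "dim_row (mat_eval (H A) 0) = dim_row (mat_direct_sum (upper_left r A) (lower_right r A))"
      "dim_col (mat_eval (H A) 0) = dim_col (mat_direct_sum (upper_left r A) (lower_right r A))"
      using A r by (simp_all add: mat_direct_sum_four_block H_def mat_eval_monom_mat upper_left_def lower_right_def)
    fix i j assume "i < dim_row (mat_direct_sum (upper_left r A) (lower_right r A))"
      "j < dim_col (mat_direct_sum (upper_left r A) (lower_right r A))"
    then have ij: "i < n" "j < n" using A r by (simp_all add: mat_direct_sum_four_block upper_left_def lower_right_def)
    then show "mat_eval (H A) 0 $$ (i, j) = mat_direct_sum (upper_left r A) (lower_right r A) $$ (i, j)"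
      using A r tri[OF that]
      by (auto simp: mat_direct_sum_four_block H_def mat_eval_monom_mat upper_left_def lower_right_def w_def block_triangular_def)
  qed
  then have "map (\<lambda>A. mat_eval (H A) 0) As = map2 mat_direct_sum (map (upper_left r) As) (map (lower_right r) As)"
    by (simp add: map2_map_map)
  ultimately show "D As = D (map (upper_left r) As) * D (map (lower_right r) As)"
    using D_direct_sum[OF ul lr] r by simp
qed

lemma D_slot_one:
  assumes "As \<in> commuting_GL l n" "n \<ge> 1" "i < l"
  shows "D (As[i := 1\<^sub>m n]) = 1"
proof -
  let ?Bs = "As[i := 1\<^sub>m n]"
  have len: "length As = l" and G: "\<And>A. A \<in> set As \<Longrightarrow> A \<in> carrier_mat n n"
    using assms by (auto simp: commuting_GL_def GL_def)
  have sub: "set ?Bs \<subseteq> insert (1\<^sub>m n) (set As)" by (rule set_update_subset_insert)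
  have cg: "?Bs \<in> commuting_GL l n"
  proof (rule commuting_GL_I)
    show "A \<in> GL n" if "A \<in> set ?Bs" for A
      using that sub assms one_GL by (auto simp: commuting_GL_def)
    show "A * B = B * A" if "A \<in> set ?Bs" "B \<in> set ?Bs" for A B
    proof -
      have "A \<in> insert (1\<^sub>m n) (set As)" "B \<in> insert (1\<^sub>m n) (set As)" using that sub by auto
      then show ?thesis
        using assms G[THEN carrier_matD(1)] G[THEN carrier_matD(2)] by (auto simp: commuting_GL_def)
    qed
  qed (simp add: len)
  have "D (?Bs[i := ?Bs ! i * 1\<^sub>m n]) = D ?Bs * D (?Bs[i := 1\<^sub>m n])"
    using cg assms one_GL by (intro D_mult_slot) (auto simp: commuting_GL_def GL_def)
  then have "D ?Bs = D ?Bs * D ?Bs" using assms len by simp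
  then show ?thesis using D_nonzero[OF cg assms(2)] by simp
qed

lemma D_slot_power:
  assumes g: "g \<in> GL n" and n: "n \<ge> 1" and es: "length es = l" and i: "i < l"
  shows "D (map (\<lambda>e. g ^\<^sub>m e) (es[i := e])) = D (map (\<lambda>e. g ^\<^sub>m e) (es[i := 1])) ^ e"
proof (induction e)
  case 0
  show ?case
    using D_slot_one[OF commuting_GL_powers[OF g es] n i] GL_carrier[OF g] by (simp add: map_update)
next
  case (Suc e)
  have gc: "g \<in> carrier_mat n n" using g GL_carrier by auto
  let ?As = "map (\<lambda>e. g ^\<^sub>m e) (es[i := e])"
  have "D (?As[i := ?As ! i * g]) = D ?As * D (?As[i := g])"
  proof (rule D_mult_slot[OF _ g n i])
    show "?As \<in> commuting_GL l n" using g es by (intro commuting_GL_powers) auto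
    show "A * g = g * A" if "A \<in> set ?As" for A
      using that pow_mat_commute[OF gc, of _ 1] gc by auto
  qed
  then show ?case using Suc gc es i by (simp add: map_update)
qed

lemma D_powers:
  assumes g: "g \<in> GL n" and n: "n \<ge> 1" and es: "length es = l"
  shows "D (map (\<lambda>e. g ^\<^sub>m e) es) = D (replicate l g) ^ prod_list es"
proof -
  have gc: "g \<in> carrier_mat n n" using g GL_carrier by auto
  \<comment> \<open>The slots are treated from left to right; \<open>fs\<close> holds the exponents that still stand in front.\<close>
  have "D (map (\<lambda>e. g ^\<^sub>m e) (fs @ es)) = D (map (\<lambda>e. g ^\<^sub>m e) (fs @ replicate (length es) 1)) ^ prod_list es"
    if "length fs + length es = l" for fs es
    using that
  proof (induction es arbitrary: fs)
    case (Cons e es)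
    let ?p = "map (\<lambda>e. g ^\<^sub>m e)"
    let ?fs = "fs @ 1 # replicate (length es) 1"
    have upd: "?fs[length fs := x] = fs @ x # replicate (length es) 1" for x :: nat
      by simp
    have "D (?p (fs @ e # es)) = D (?p (fs @ e # replicate (length es) 1)) ^ prod_list es"
      using Cons.IH[of "fs @ [e]"] Cons.prems by simp
    also have "D (?p (fs @ e # replicate (length es) 1)) = D (?p ?fs) ^ e"
      using D_slot_power[OF g n, of ?fs "length fs" e] Cons.prems unfolding upd by simp
    finally show ?case by (simp add: power_mult)
  qed simp
  from this[of "[]" es] es gc show ?thesis by simp
qed

end

section \<open>Finite fields and their quadratic extensions\<close>

text \<open>A quadratic with constant term \<open>h\<close> and a root \<open>x\<close> has linear coefficient \<open>s = x + h / x\<close>, and there are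
fewer nonzero \<open>x\<close> than candidates for \<open>s\<close>.\<close>

lemma finite_field_irreducible_quadratic:
  fixes h :: "'a::{field,finite}"
  assumes "h \<noteq> 0"
  obtains s where "\<And>x. x * x - s * x + h \<noteq> 0"
proof -
  have "card ((\<lambda>x. x + h / x) ` (UNIV - {0})) \<le> card (UNIV - {0 :: 'a})"
    by (rule card_image_le) simp
  also have "\<dots> < card (UNIV :: 'a set)" by (rule psubset_card_mono) auto
  finally have "(\<lambda>x. x + h / x) ` (UNIV - {0}) \<noteq> UNIV" by auto
  then obtain s where s: "s \<notin> (\<lambda>x. x + h / x) ` (UNIV - {0})" by blast
  have "x * x - s * x + h \<noteq> 0" for x
  proof
    assume eq: "x * x - s * x + h = 0"
    with assms have x: "x \<noteq> 0" by auto
    with eq have "s = x + h / x" by (simp add: field_simps)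
    with s x show False by blast
  qed
  with that show thesis by blast
qed

lemma pow_smult_one: "(c \<cdot>\<^sub>m 1\<^sub>m n) ^\<^sub>m e = (c :: 'a::comm_ring_1) ^ e \<cdot>\<^sub>m 1\<^sub>m n"
  by (induction e) (auto intro!: eq_matI)

lemma mat_1x1: "A \<in> carrier_mat 1 1 \<Longrightarrow> A = (A $$ (0, 0) :: 'a::comm_ring_1) \<cdot>\<^sub>m 1\<^sub>m 1"
  by (rule eq_matI) auto

lemma det_pow_mat:
  fixes A :: "'a::comm_ring_1 mat"
  shows "A \<in> carrier_mat n n \<Longrightarrow> det (A ^\<^sub>m e) = det A ^ e"
  by (induction e) (auto simp: det_mult[of _ n])

lemma det_2x2:
  fixes A :: "'a::field mat"
  assumes A: "A \<in> carrier_mat 2 2"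
  shows "det A = A $$ (0, 0) * A $$ (1, 1) - A $$ (0, 1) * A $$ (1, 0)"
proof -
  let ?c = "\<lambda>i j. mat 1 1 (\<lambda>_. A $$ (i, j))"
  have blocks: "A = four_block_mat (?c 0 0) (?c 0 1) (?c 1 0) (?c 1 1)"
    using A by (intro eq_matI) (auto simp: numeral_2_eq_2 less_Suc_eq)
  have "det A = det (?c 0 0 * ?c 1 1 - ?c 0 1 * ?c 1 0)"
    unfolding arg_cong[OF blocks, of det]
    by (rule det_four_block_mat) (auto simp: scalar_prod_def intro!: eq_matI)
  also have "\<dots> = A $$ (0, 0) * A $$ (1, 1) - A $$ (0, 1) * A $$ (1, 0)"
    by (subst det_single) (auto simp: scalar_prod_def)
  finally show ?thesis .
qed

text \<open>Since \<open>1 \<times> 1\<close> matrices have no proper blocks, the dichotomy for commuting matrices leaves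
only the cyclic case.\<close>

lemma finite_field_primitive_element:
  obtains h :: "'a::{field,finite}" where "h \<noteq> 0" "\<And>a. a \<noteq> 0 \<Longrightarrow> \<exists>e. a = h ^ e"
proof -
  have "GL 1 \<subseteq> (GL 1 :: 'a mat set)" "1 \<le> (1 :: nat)" by simp_all
  moreover have "\<forall>A\<in>GL 1. \<forall>B\<in>GL 1. A * B = B * (A :: 'a mat)"
    using mat_1x1 smult_one_commute GL_carrier by metis
  ultimately show thesis
  proof (cases rule: commuting_cyclic_or_triangular[consumes 3])
    case (cyclic g)
    let ?h = "g $$ (0, 0)"
    have g: "g = ?h \<cdot>\<^sub>m 1\<^sub>m 1" using cyclic(1) GL_carrier mat_1x1 by blast
    show thesis
    proof (rule that)
      show "?h \<noteq> 0" using cyclic(1) by (auto simp: GL_iff_det det_single)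
      fix a :: 'a assume "a \<noteq> 0"
      then have "a \<cdot>\<^sub>m 1\<^sub>m 1 \<in> GL 1" by (intro smult_one_GL[of _ "1 / a"]) simp
      then obtain e where "a \<cdot>\<^sub>m 1\<^sub>m 1 = g ^\<^sub>m e" using cyclic(2) by blast
      then have "a \<cdot>\<^sub>m 1\<^sub>m 1 = ?h ^ e \<cdot>\<^sub>m 1\<^sub>m 1" by (subst (asm) g) (simp only: pow_smult_one)
      from arg_cong[OF this, of "\<lambda>M. M $$ (0, 0)"] show "\<exists>e. a = ?h ^ e" by auto
    qed
  qed auto
qed

text \<open>The companion matrix of \<open>X\<^sup>2 - s X + h\<close>.\<close>

definition companion2 :: "'a::comm_ring_1 \<Rightarrow> 'a \<Rightarrow> 'a mat" where
  "companion2 s h = mat 2 2 (\<lambda>(i, j). if i = 0 then (if j = 0 then 0 else - h) else (if j = 0 then 1 else s))"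

lemma companion2_carrier: "companion2 s h \<in> carrier_mat 2 2"
  by (simp add: companion2_def)

lemma det_companion2: "det (companion2 s h :: 'a::field mat) = h"
  by (subst det_2x2) (auto simp: companion2_def)

text \<open>A common triangular form of the companion matrix and the scalars would exhibit an eigenvalue, that is,
a root of the characteristic polynomial.\<close>

lemma companion2_cyclic:
  fixes h s :: "'a::{field,finite}"
  assumes h: "h \<noteq> 0" and irr: "\<And>x. x * x - s * x + h \<noteq> 0"
  obtains g d m where "g \<in> GL 2" "companion2 s h = g ^\<^sub>m d" "h \<cdot>\<^sub>m 1\<^sub>m 2 = g ^\<^sub>m m"
proof -
  let ?C = "companion2 s h"
  have C: "?C \<in> carrier_mat 2 2" "?C \<in> GL 2" using h
    by (auto simp: GL_iff_det det_companion2 companion2_carrier)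
  have hG: "h \<cdot>\<^sub>m 1\<^sub>m 2 \<in> GL 2" using h by (intro smult_one_GL[of _ "1 / h"]) simp
  have sub: "{?C, h \<cdot>\<^sub>m 1\<^sub>m 2} \<subseteq> GL 2" using C hG by simp
  have comm: "\<forall>A\<in>{?C, h \<cdot>\<^sub>m 1\<^sub>m 2}. \<forall>B\<in>{?C, h \<cdot>\<^sub>m 1\<^sub>m 2}. A * B = B * A"
    using smult_one_commute[OF C(1), of h] by auto
  have "1 \<le> (2 :: nat)" by simp
  from sub this comm show thesis
  proof (cases rule: commuting_cyclic_or_triangular[consumes 3])
    case (cyclic g)
    with that show thesis by blast
  next
    case (triangular P T r)
    note PT = triangular(1-4)
    have "r = 1" using triangular(5,6) by simp
    then have z: "(P * ?C * T) $$ (1, 0) = 0"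
      using triangular(7)[of ?C] PT(1) unfolding block_triangular_def by simp
    define x where "x = (P * ?C * T) $$ (0, 0)"
    have xc: "x \<cdot>\<^sub>m 1\<^sub>m 2 \<in> carrier_mat 2 2" by simp
    have "P * (?C - x \<cdot>\<^sub>m 1\<^sub>m 2) * T = P * ?C * T - P * (x \<cdot>\<^sub>m 1\<^sub>m 2) * T"
      using PT C by (simp add: mult_minus_distrib_mat[of _ 2 2 _ 2] minus_mult_distrib_mat[of _ 2 2 _ _ 2])
    also have "P * (x \<cdot>\<^sub>m 1\<^sub>m 2) * T = x \<cdot>\<^sub>m 1\<^sub>m 2"
      using PT by (simp add: mult_smult_distrib[of _ 2 2 _ 2] mult_smult_assoc_mat[of _ 2 2 _ 2])
    finally have eq: "P * (?C - x \<cdot>\<^sub>m 1\<^sub>m 2) * T = P * ?C * T - x \<cdot>\<^sub>m 1\<^sub>m 2" .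
    have PCT: "P * ?C * T \<in> carrier_mat 2 2" using PT C by auto
    have "det (P * ?C * T - x \<cdot>\<^sub>m 1\<^sub>m 2) = 0"
      using PCT z x_def by (subst det_2x2) (auto simp del: index_mult_mat(1))
    moreover have "det (P * (?C - x \<cdot>\<^sub>m 1\<^sub>m 2) * T) = det P * det (?C - x \<cdot>\<^sub>m 1\<^sub>m 2) * det T"
      using PT(1,2) minus_carrier_mat[OF xc, of ?C]
      by (simp add: det_mult[of "?C - x \<cdot>\<^sub>m 1\<^sub>m 2" 2 T] det_mult[of P 2 "(?C - x \<cdot>\<^sub>m 1\<^sub>m 2) * T"])
    moreover have "det P \<noteq> 0" "det T \<noteq> 0"
      using GL_I[OF PT] GL_I[OF PT(2,1,4,3)] by (auto simp: GL_iff_det)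
    ultimately have "det (?C - x \<cdot>\<^sub>m 1\<^sub>m 2) = 0" using eq by simp
    also have "det (?C - x \<cdot>\<^sub>m 1\<^sub>m 2) = x * x - s * x + h"
      using C by (subst det_2x2) (auto simp: companion2_def algebra_simps)
    finally show thesis using irr by simp
  qed
qed

section \<open>Elimination of the first column\<close>

text \<open>A single transvection carries the first column \<open>a\<close> of \<open>A\<close> to \<open>e\<^sub>0\<close>: take \<open>N = u v\<^sup>T\<close> with \<open>u = e\<^sub>0 - a\<close> and \<open>v\<close>
such that \<open>v \<bullet> a = 1\<close> and \<open>v \<bullet> e\<^sub>0 = 1\<close>. Then \<open>v \<bullet> u = 0\<close> gives \<open>N\<^sup>2 = 0\<close>, and \<open>a + N a = a + u = e\<^sub>0\<close>. Such a
\<open>v\<close> exists because \<open>a\<close> has a nonzero entry besides the first one.\<close>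

lemma clear_first_column:
  fixes A :: "'a::field mat"
  assumes A: "A \<in> carrier_mat n n" and i: "0 < i" "i < n" and nz: "A $$ (i, 0) \<noteq> 0"
  obtains N where "N \<in> carrier_mat n n" "N * N = 0\<^sub>m n n" "block_triangular 1 ((1\<^sub>m n + N) * A)"
proof -
  define u where "u p = (if p = 0 then 1 else 0) - A $$ (p, 0)" for p
  define c where "c = (1 - A $$ (0, 0)) / A $$ (i, 0)"
  define v where "v q = (if q = 0 then 1 else 0) + (if q = i then c else 0)" for q
  define N where "N = mat n n (\<lambda>(p, q). u p * v q)"
  have N: "N \<in> carrier_mat n n" by (simp add: N_def)
  have v_sum: "(\<Sum>k<n. v k * f k) = f 0 + c * f i" for f
    using i by (simp add: v_def distrib_right sum.distrib if_distrib[of "\<lambda>x. x * _"] cong: if_cong)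
  have "N * N = 0\<^sub>m n n"
  proof (rule eq_matI)
    fix p q assume "p < dim_row (0\<^sub>m n n :: 'a mat)" "q < dim_col (0\<^sub>m n n :: 'a mat)"
    then have pq: "p < n" "q < n" by auto
    have "(N * N) $$ (p, q) = (\<Sum>k<n. N $$ (p, k) * N $$ (k, q))"
      using N pq by (intro mult_mat_entry) auto
    also have "\<dots> = (\<Sum>k<n. u p * v q * (v k * u k))"
      using pq by (intro sum.cong) (auto simp: N_def)
    also have "\<dots> = u p * v q * (u 0 + c * u i)"
      by (simp only: sum_distrib_left[symmetric] v_sum)
    also have "u 0 + c * u i = 0" using i nz by (simp add: u_def c_def)
    finally show "(N * N) $$ (p, q) = 0\<^sub>m n n $$ (p, q)" using pq by simp
  qed (use N in auto)
  moreover have "block_triangular 1 ((1\<^sub>m n + N) * A)"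
    unfolding block_triangular_def
  proof (intro allI impI)
    fix p q :: nat assume "1 \<le> p" "p < dim_row ((1\<^sub>m n + N) * A)" "q < 1"
    then have p: "1 \<le> p" "p < n" "q = 0" using N by auto
    have "(1\<^sub>m n + N) * A = A + N * A" using N A by (simp add: add_mult_distrib_mat[of _ n n _ _ n])
    moreover have "(N * A) $$ (p, 0) = (\<Sum>k<n. N $$ (p, k) * A $$ (k, 0))"
      using N A p by (intro mult_mat_entry) auto
    moreover have "\<dots> = (\<Sum>k<n. u p * (v k * A $$ (k, 0)))"
      using p by (intro sum.cong) (auto simp: N_def)
    moreover have "\<dots> = u p * (A $$ (0, 0) + c * A $$ (i, 0))"
      by (simp only: sum_distrib_left[symmetric] v_sum)
    moreover have "\<dots> = u p" using nz by (simp add: c_def)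
    ultimately show "((1\<^sub>m n + N) * A) $$ (p, q) = 0"
      using p N A by (simp add: u_def del: index_mult_mat(1))
  qed
  ultimately show thesis using that[OF N] by blast
qed

section \<open>Triviality over a finite field\<close>

locale joint_det_finite = joint_det l D
  for l :: nat and D :: "'k::{field,finite} mat list \<Rightarrow> 'k" +
  assumes l_ge_2: "l \<ge> 2"
begin

text \<open>An instance of the projection formula for the norm of a quadratic extension, which sends the companion
matrix \<open>C\<close> to \<open>h\<close>: a transvection turns \<open>C\<close> into an upper triangular matrix with diagonal \<open>1, h\<close>, while
scalars stay fixed. The first diagonal tuple contains an entry \<open>1\<close> and contributes nothing; the
second one has \<open>h\<close> in every slot, whichever slots were scalar before.\<close>

lemma D_companion2:
  assumes h: "h \<noteq> 0" and bs: "length bs = l" "True \<in> set bs"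
  shows "D (map (\<lambda>b. if b then companion2 s h else h \<cdot>\<^sub>m 1\<^sub>m 2) bs) = D (replicate l (h \<cdot>\<^sub>m 1\<^sub>m 1))"
proof -
  let ?C = "companion2 s h"
  have C: "?C \<in> carrier_mat 2 2" "?C \<in> GL 2" using h
    by (auto simp: GL_iff_det det_companion2 companion2_carrier)
  \<comment> \<open>\<open>N = (e\<^sub>0 - e\<^sub>1) (e\<^sub>0 + e\<^sub>1)\<^sup>T\<close>; the transvection \<open>1 + N\<close> carries the first column \<open>e\<^sub>1\<close> of \<open>C\<close> to \<open>e\<^sub>0\<close>.\<close>
  define N :: "'k mat" where "N = mat 2 2 (\<lambda>(i, j). if i = 0 then 1 else - 1)"
  have N: "N \<in> carrier_mat 2 2" "N * N = 0\<^sub>m 2 2"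
    by (auto simp: N_def scalar_prod_def numeral_2_eq_2 intro!: eq_matI)
  define T where "T = (1\<^sub>m 2 + N) * ?C"
  have T: "T \<in> GL 2" unfolding T_def by (rule mult_GL[OF transvection_GL[OF N] C(2)])
  have T_mat: "T = mat 2 2 (\<lambda>(i, j). if i = 0 then (if j = 0 then 1 else s - 2 * h) else (if j = 0 then 0 else h))"
    unfolding T_def by (rule eq_matI) (auto simp: N_def companion2_def scalar_prod_def less_2_cases_iff numeral_2_eq_2)
  let ?As = "map (\<lambda>b. if b then T else h \<cdot>\<^sub>m 1\<^sub>m 2) bs"
  have hG: "h \<cdot>\<^sub>m 1\<^sub>m n \<in> GL n" for n using h by (intro smult_one_GL[of _ "1 / h"]) simp
  have As: "?As \<in> commuting_GL l 2"
    using T hG bs by (intro commuting_GL_pair smult_one_commute GL_carrier) auto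
  have tri: "block_triangular 1 A" if "A \<in> set ?As" for A
    using that by (auto simp: block_triangular_def T_mat split: if_splits)
  have ulT: "upper_left 1 T = 1\<^sub>m 1" and ulh: "upper_left 1 (h \<cdot>\<^sub>m 1\<^sub>m 2) = h \<cdot>\<^sub>m 1\<^sub>m 1"
    by (auto simp: T_mat upper_left_def intro!: eq_matI)
  have lrT: "lower_right 1 T = h \<cdot>\<^sub>m 1\<^sub>m 1" and lrh: "lower_right 1 (h \<cdot>\<^sub>m 1\<^sub>m 2) = h \<cdot>\<^sub>m 1\<^sub>m 1"
    by (auto simp: T_mat lower_right_def intro!: eq_matI)
  let ?Us = "map (\<lambda>b. if b then 1\<^sub>m 1 else h \<cdot>\<^sub>m 1\<^sub>m 1) bs"
  have Us: "map (upper_left 1) ?As = ?Us"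
    unfolding map_map o_def if_distrib[of "upper_left 1"] ulT ulh ..
  have Ls: "map (lower_right 1) ?As = replicate l (h \<cdot>\<^sub>m 1\<^sub>m 1)"
    unfolding map_map o_def if_distrib[of "lower_right 1"] lrT lrh if_cancel bs(1)[symmetric]
    by (rule map_replicate_const)
  obtain i where i: "i < l" "bs ! i" using bs by (auto simp: in_set_conv_nth)
  have "D (?Us[i := 1\<^sub>m 1]) = 1"
    using D_block_triangular(1)[OF As _ _ tri] i unfolding Us by (intro D_slot_one) auto
  moreover have "?Us[i := 1\<^sub>m 1] = ?Us" using i bs by (intro list_update_same_conv[THEN iffD2]) auto
  ultimately have "D ?As = D (replicate l (h \<cdot>\<^sub>m 1\<^sub>m 1))"
    using D_block_triangular(3)[OF As _ _ tri] unfolding Us Ls by simp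
  with D_transvection[OF C(2) N _ h bs(1)] show ?thesis by (simp add: T_def[symmetric] cong: if_cong)
qed

text \<open>Write \<open>C = g\<^sup>d\<close> and \<open>h = g\<^sup>m\<close> in the field generated by \<open>C\<close>, and let \<open>\<delta> = D (g, \<dots>, g)\<close>. The two values
\<open>D (C, C, \<dots>, C)\<close> and \<open>D (h, C, \<dots>, C)\<close> both equal \<open>\<epsilon> = D (h, \<dots>, h)\<close> by the projection formula, which requires
\<open>C\<close> to keep at least one slot. Determinants show \<open>h = (det g)\<^sup>d\<close> and \<open>h\<^sup>2 = (det g)\<^sup>m\<close>, so \<open>h\<^sup>m = h\<^sup>2\<^sup>d\<close>, and the same
holds for the power \<open>\<delta>\<close> of \<open>h\<close>: for \<open>D\<close> the entry \<open>h\<close> counts like \<open>C\<^sup>2\<close>. Comparing the two values yields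
\<open>\<epsilon> = \<epsilon>\<^sup>2\<close>.\<close>

lemma D_replicate_primitive:
  assumes h: "h \<noteq> 0" and prim: "\<And>a. a \<noteq> 0 \<Longrightarrow> \<exists>e. a = h ^ e"
  shows "D (replicate l (h \<cdot>\<^sub>m 1\<^sub>m 1)) = 1"
proof -
  obtain s where irr: "\<And>x. x * x - s * x + h \<noteq> 0"
    using finite_field_irreducible_quadratic[OF h] by blast
  obtain g d m where g: "g \<in> GL 2" and C: "companion2 s h = g ^\<^sub>m d" and hI: "h \<cdot>\<^sub>m 1\<^sub>m 2 = g ^\<^sub>m m"
    using companion2_cyclic[OF h irr] by blast
  have gc: "g \<in> carrier_mat 2 2" using g GL_carrier by blast
  define \<delta> where "\<delta> = D (replicate l g)"
  define \<epsilon> where "\<epsilon> = D (replicate l (h \<cdot>\<^sub>m 1\<^sub>m 1))"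
  have pow: "\<epsilon> = \<delta> ^ prod_list (map (\<lambda>b. if b then d else m) bs)" if "length bs = l" "True \<in> set bs" for bs
  proof -
    have "\<epsilon> = D (map (\<lambda>b. if b then companion2 s h else h \<cdot>\<^sub>m 1\<^sub>m 2) bs)"
      using D_companion2[OF h that] by (simp add: \<epsilon>_def)
    also have "\<dots> = D (map (\<lambda>e. g ^\<^sub>m e) (map (\<lambda>b. if b then d else m) bs))"
      by (simp add: o_def C hI if_distrib cong: if_cong)
    also have "\<dots> = \<delta> ^ prod_list (map (\<lambda>b. if b then d else m) bs)"
      unfolding \<delta>_def using g that by (intro D_powers) auto
    finally show ?thesis .
  qed
  obtain k where l: "l = Suc (Suc k)" using l_ge_2 by (metis Suc_le_D numeral_2_eq_2 Suc_le_mono)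
  have \<epsilon>1: "\<epsilon> = \<delta> ^ (d * d ^ Suc k)"
    using pow[of "replicate l True"] by (simp add: l)
  have \<epsilon>2: "\<epsilon> = \<delta> ^ (m * d ^ Suc k)"
    using pow[of "False # replicate (Suc k) True"] by (simp add: l)
  have hd: "h = det g ^ d"
    using det_companion2[of s h] det_pow_mat[OF gc, of d] by (simp add: C)
  have "h ^ 2 = det g ^ m"
    using det_pow_mat[OF gc, of m] by (simp add: hI[symmetric])
  then have hm: "h ^ m = h ^ (2 * d)"
    by (metis hd power_mult mult.commute)
  have "replicate l g \<in> commuting_GL l 2" using g by (auto simp: commuting_GL_def)
  then have "\<delta> \<noteq> 0" unfolding \<delta>_def by (rule D_nonzero) simp
  then obtain e where "\<delta> = h ^ e" using prim by blast
  then have "\<delta> ^ m = \<delta> ^ (2 * d)"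
    using hm by (metis power_mult mult.commute)
  then have "\<epsilon> = \<epsilon> ^ 2"
    using \<epsilon>1 \<epsilon>2 by (metis power_mult mult.assoc mult.commute)
  moreover have "\<epsilon> \<noteq> 0" using \<epsilon>1 \<open>\<delta> \<noteq> 0\<close> by simp
  ultimately show ?thesis by (simp add: \<epsilon>_def power2_eq_square)
qed

lemma D_cyclic:
  assumes "g \<in> GL n" "n \<ge> 1" "length As = l" "\<And>A. A \<in> set As \<Longrightarrow> \<exists>e. A = g ^\<^sub>m e"
    and "D (replicate l g) = 1"
  shows "D As = 1"
proof -
  obtain es where "As = map (\<lambda>e. g ^\<^sub>m e) es" using assms(4) ex_map_conv by metis
  with D_powers[OF assms(1,2), of es] assms show ?thesis by simp
qed

lemma D_1x1:
  assumes As: "As \<in> commuting_GL l 1"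
  shows "D As = 1"
proof -
  obtain h :: 'k where h: "h \<noteq> 0" and prim: "\<And>a. a \<noteq> 0 \<Longrightarrow> \<exists>e. a = h ^ e"
    using finite_field_primitive_element by blast
  show ?thesis
  proof (rule D_cyclic)
    show "h \<cdot>\<^sub>m 1\<^sub>m 1 \<in> GL 1" using h by (intro smult_one_GL[of _ "1 / h"]) simp
    show "D (replicate l (h \<cdot>\<^sub>m 1\<^sub>m 1)) = 1" by (rule D_replicate_primitive[OF h prim])
    fix A assume "A \<in> set As"
    then have A: "A \<in> carrier_mat 1 1" "det A \<noteq> 0" using As by (auto simp: commuting_GL_def GL_iff_det)
    then have "A $$ (0, 0) \<noteq> 0" by (simp add: det_single)
    then obtain e where "A $$ (0, 0) = h ^ e" using prim by blast
    then show "\<exists>e. A = (h \<cdot>\<^sub>m 1\<^sub>m 1) ^\<^sub>m e" using mat_1x1[OF A(1)] by (auto simp: pow_smult_one)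
  qed (use As in \<open>auto simp: commuting_GL_def\<close>)
qed

text \<open>A tuple with a single repeated matrix may be changed by transvections until its first column is
clear, and then splits off a \<open>1 \<times> 1\<close> block.\<close>

lemma D_replicate: "A \<in> GL n \<Longrightarrow> n \<ge> 1 \<Longrightarrow> D (replicate l A) = 1"
proof (induction n arbitrary: A rule: less_induct)
  case (less n)
  have tri: "D (replicate l B) = 1" if B: "B \<in> GL n" "block_triangular 1 B" "n > 1" for B
  proof -
    have "0 < (1::nat)" by simp
    note split = D_block_triangular[OF commuting_GL_replicate[OF B(1)] this B(3)]
    have "map (lower_right 1) (replicate l B) \<in> commuting_GL l (n - 1)" using split(2) B(2) by simp
    then have "lower_right 1 B \<in> GL (n - 1)" using l_ge_2 by (auto simp: commuting_GL_def)
    then have "D (replicate l (lower_right 1 B)) = 1" using less.IH[of "n - 1"] B(3) by simp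
    moreover have "D (map (upper_left 1) (replicate l B)) = 1" using split(1) B(2) by (intro D_1x1) simp
    ultimately show ?thesis using split(3) B(2) by simp
  qed
  have Ac: "A \<in> carrier_mat n n" using less.prems GL_carrier by blast
  show ?case
  proof (cases "n = 1")
    case True
    then show ?thesis using less.prems commuting_GL_replicate by (intro D_1x1) simp
  next
    case False
    with less.prems have n: "n > 1" by simp
    show ?thesis
    proof (cases "block_triangular 1 A")
      case True
      then show ?thesis using tri less.prems n by blast
    next
      case False
      then obtain i where "1 \<le> i" "i < n" "A $$ (i, 0) \<noteq> 0"
        unfolding block_triangular_def carrier_matD(1)[OF Ac] by (metis less_one)
      then have "0 < i" "i < n" "A $$ (i, 0) \<noteq> 0" by simp_all
      with Ac obtain N where N: "N \<in> carrier_mat n n" "N * N = 0\<^sub>m n n"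
        and "block_triangular 1 ((1\<^sub>m n + N) * A)"
        by (rule clear_first_column)
      have "D (replicate l ((1\<^sub>m n + N) * A)) = D (replicate l A)"
        using D_transvection[OF less.prems(1) N(1,2) less.prems(2), of 1 "replicate l True"] by simp
      moreover have "(1\<^sub>m n + N) * A \<in> GL n"
        by (rule mult_GL[OF transvection_GL[OF N(1,2)] less.prems(1)])
      ultimately show ?thesis using tri \<open>block_triangular 1 ((1\<^sub>m n + N) * A)\<close> n by simp
    qed
  qed
qed

text \<open>Induction on the size: a tuple that can be made block triangular is a product of smaller ones, and any
other tuple consists of powers of one matrix \<open>g\<close>, so that its value is a power of \<open>D (g, \<dots>, g)\<close>.\<close>

lemma D_trivial: "As \<in> commuting_GL l n \<Longrightarrow> n \<ge> 1 \<Longrightarrow> D As = 1"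
proof (induction n arbitrary: As rule: less_induct)
  case (less n)
  have G: "set As \<subseteq> GL n" and comm: "\<forall>A\<in>set As. \<forall>B\<in>set As. A * B = B * A"
    and len: "length As = l"
    using less.prems by (auto simp: commuting_GL_def)
  from G less.prems(2) comm show ?case
  proof (cases rule: commuting_cyclic_or_triangular[consumes 3])
    case (cyclic g)
    then show ?thesis using D_cyclic[OF cyclic(1) less.prems(2) len] D_replicate less.prems(2) by blast
  next
    case (triangular P T r)
    let ?Bs = "map (\<lambda>A. P * A * T) As"
    have PT: "P \<in> GL n" "T \<in> GL n" using triangular(1-4) by (auto intro: GL_I)
    have conj: "P * A * T * (P * B * T) = P * (A * B) * T" if "A \<in> carrier_mat n n" "B \<in> carrier_mat n n" for A B
    proof -
      have "P * A * T * (P * B * T) = P * A * (T * P) * B * T"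
        using that triangular(1,2) by (simp add: assoc_mult_mat[of _ n n _ n _ n])
      also have "\<dots> = P * (A * B) * T" 
        unfolding triangular(4) using that triangular(1,2) by (simp add: assoc_mult_mat[of _ n n _ n _ n])
      finally show ?thesis .
    qed
    have Bs: "?Bs \<in> commuting_GL l n"
    proof (rule commuting_GL_I)
      fix X Y assume "X \<in> set ?Bs" "Y \<in> set ?Bs"
      then obtain A B where "A \<in> set As" "X = P * A * T" "B \<in> set As" "Y = P * B * T" by auto
      then show "X * Y = Y * X"
        using conj[of A B] conj[of B A] comm G GL_carrier by (metis subsetD)
    qed (use len PT G in \<open>auto intro!: mult_GL\<close>)
    have tri: "block_triangular r B" if "B \<in> set ?Bs" for B
      using that triangular(7) by auto
    note split = D_block_triangular[OF Bs triangular(5,6) tri]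
    have "D ?Bs = 1"
      using less.IH[OF _ split(1)] less.IH[OF _ split(2)] split(3) triangular(5,6) by simp
    then show ?thesis using D_similar[OF less.prems triangular(1-4)] by simp
  qed
qed

end

theorem corollary7p5:
  fixes l :: nat
  assumes "l \<ge> 2"
  shows "\<not> (\<exists>D :: 'k::{field,finite} mat list \<Rightarrow> 'k.
           nontrivial_joint_determinant mult_group l D)"
proof
  assume "\<exists>D :: 'k mat list \<Rightarrow> 'k. nontrivial_joint_determinant mult_group l D"
  then obtain D :: "'k mat list \<Rightarrow> 'k" and As where D: "joint_determinant mult_group l D"
    and As: "As \<in> commuting_tuples l" "D As \<noteq> 1"
    by (auto simp: nontrivial_joint_determinant_def mult_group_def)
  interpret joint_det_finite l D using D assms by unfold_locales
  from As D_trivial show False by (auto simp: commuting_tuples_def)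
qed

end
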